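(* Let $\mathcal C$ be a real polynomial curve with proper real polynomial parametrization written in complex form as $z(t)=x(t)+\mathbf i\,y(t)$, and let $z_0\in\mathbb C$. Define $z^\star(t)=-z(t)+2z_0$. Then $\mathcal C$ is symmetric with respect to the point $z_0$ (identifying $\mathbb R^2$ with $\mathbb C$) if and only if there exist $\alpha,\beta\in\mathbb R$ with $\alpha\neq0$ such that $z^\star(t)=z(\alpha t+\beta)$. Consequently, $\mathcal C$ has central symmetry if and only if such $z_0\in\mathbb C$ and $\alpha,\beta\in\mathbb R$, $\alpha\ne 0$, exist.
   Context: A real polynomial curve is $\mathcal C=\{(x(t),y(t)):t\in\mathbb R\}$ with $x,y\in\mathbb R[t]$ not both constant; the parametrization is proper if it is injective for almost all $t$. Points $(x,y)$ are identified with $x+\mathbf i y\in\mathbb C$. $\mathcal C$ is symmetric with respect to $z_0$ if the point reflection $z\mapsto 2z_0-z$ maps $\mathcal C$ onto itself; $\mathcal C$ has central symmetry if it is symmetric with respect to some point.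
   Formalization: "Proper" is taken as injective for all but finitely many complex parameters t (birational); with injectivity only for real t the claim fails, e.g. x=t^3+t, y=0, z_0=1. *)

theory Defs
  imports Complex_Main "HOL-Computational_Algebra.Polynomial"
begin

definition zpar :: "real poly \<Rightarrow> real poly \<Rightarrow> real \<Rightarrow> complex" where
  "zpar x y t = Complex (poly x t) (poly y t)"

definition pcurve :: "real poly \<Rightarrow> real poly \<Rightarrow> complex set" where
  "pcurve x y = range (zpar x y)"

definition proper_param :: "real poly \<Rightarrow> real poly \<Rightarrow> bool" where
  "proper_param x y \<longleftrightarrow>
     finite {t::complex. \<exists>s. s \<noteq> t \<and>
        poly (map_poly complex_of_real x) s = poly (map_poly complex_of_real x) t \<and>
        poly (map_poly complex_of_real y) s = poly (map_poly complex_of_real y) t}"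

definition symmetric_wrt :: "complex set \<Rightarrow> complex \<Rightarrow> bool" where
  "symmetric_wrt C z0 \<longleftrightarrow> (\<lambda>z. 2 * z0 - z) ` C = C"

definition central_symmetry :: "complex set \<Rightarrow> bool" where
  "central_symmetry C \<longleftrightarrow> (\<exists>z0. symmetric_wrt C z0)"

end

theory Submission
  imports
    Defs
    "HOL-Complex_Analysis.Complex_Analysis"
    "HOL-Computational_Algebra.Fundamental_Theorem_Algebra"
    "HOL-Computational_Algebra.Field_as_Ring"
    "Subresultants.Subresultant_Gcd"
begin

text \<open>
  If the curve is symmetric, every real \<open>t\<close> has a real \<open>s\<close> with \<open>z s = z\<^sup>\<star> t\<close>. A resultant that
  vanishes at infinitely many \<open>t\<close> vanishes identically, so every complex \<open>t\<close> has such a complex \<open>s\<close>.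
  By properness \<open>s = \<phi> t\<close> is unique for all but finitely many \<open>t\<close>; away from these exceptions
  \<open>\<phi>\<close> is holomorphic, and since \<open>\<bar>x s\<bar>\<close> grows at least linearly in \<open>\<bar>s\<bar>\<close> it is locally bounded and of
  polynomial growth. So \<open>\<phi>\<close> extends to a polynomial, and comparing degrees in \<open>x (\<phi> t) = x\<^sup>\<star> t\<close>
  shows that it is affine; it is real because it maps infinitely many reals to reals.
\<close>

section \<open>Resultants and common preimages over the complex numbers\<close>

text \<open>Common roots are the roots of the gcd, and a nonzero complex polynomial has a root iff
  its degree is positive.\<close>

lemma common_root_iff_resultant:
  fixes p q :: "complex poly"
  assumes "degree p > 0"
  shows "(\<exists>s. poly p s = 0 \<and> poly q s = 0) \<longleftrightarrow> resultant p q = 0"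
proof -
  have nz: "gcd p q \<noteq> 0"
    using assms by auto
  have "(\<exists>s. poly p s = 0 \<and> poly q s = 0) \<longleftrightarrow> (\<exists>s. poly (gcd p q) s = 0)"
    by (simp add: poly_eq_0_iff_dvd)
  also have "\<dots> \<longleftrightarrow> degree (gcd p q) \<noteq> 0"
  proof
    assume "\<exists>s. poly (gcd p q) s = 0"
    then show "degree (gcd p q) \<noteq> 0"
      using nz by (metis degree_eq_zeroE poly_const_conv pCons_0_0)
  next
    assume "degree (gcd p q) \<noteq> 0"
    then show "\<exists>s. poly (gcd p q) s = 0"
      using fundamental_theorem_of_algebra[of "gcd p q"] by (simp add: constant_degree)
  qed
  finally show ?thesis
    by (simp add: resultant_0_gcd)
qed

text \<open>The admissible \<open>t\<close> form the zero set of one polynomial in \<open>t\<close>,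
  the resultant with respect to \<open>s\<close> of \<open>X s - U t\<close> and
  \<open>Y s - V t\<close>.\<close>

lemma common_preimage_everywhere:
  fixes X Y U V :: "complex poly"
  assumes degX: "degree X > 0"
    and inf: "infinite {t. \<exists>s. poly X s = poly U t \<and> poly Y s = poly V t}"
  shows "\<exists>s. poly X s = poly U t \<and> poly Y s = poly V t"
proof (cases "degree Y = 0")
  \<comment> \<open>Here \<open>V\<close> takes the value \<open>c\<close> infinitely often, hence
    always, and only the equation for \<open>X\<close> remains to be solved.\<close>
  case True
  then obtain c where Y: "Y = [:c:]"
    by (meson degree_eq_zeroE)
  have "infinite {t. poly (V - [:c:]) t = 0}"
    by (rule infinite_super[OF _ inf]) (auto simp: Y)
  then have "V - [:c:] = 0"
    using poly_roots_finite by blast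
  then have V: "V = [:c:]"
    by simp
  have "degree (X + [:- poly U t:]) = degree X"
    using degX by (intro degree_add_eq_left) auto
  then have "\<not> constant (poly (X + [:- poly U t:]))"
    using degX by (simp add: constant_degree)
  then obtain s where "poly (X + [:- poly U t:]) s = 0"
    using fundamental_theorem_of_algebra by blast
  then show ?thesis
    by (intro exI[of _ s]) (auto simp: Y V)
next
  case False
  \<comment> \<open>The outer variable is \<open>s\<close>, the inner one \<open>t\<close>. Both \<open>s\<close>-degrees survive specialising \<open>t\<close>,
    as the leading coefficients do not involve \<open>t\<close>; so the resultant can be specialised too.\<close>
  define bi :: "complex poly \<Rightarrow> complex poly \<Rightarrow> complex poly poly"
    where "bi p u = map_poly (\<lambda>c. [:c:]) p + [:- u:]" for p u
  define sl :: "complex poly \<Rightarrow> complex poly \<Rightarrow> complex \<Rightarrow> complex poly"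
    where "sl p u t = p + [:- poly u t:]" for p u t
  have deg_bi: "degree (bi p u) = degree p" if "degree p > 0" for p u
  proof -
    have "degree (map_poly (\<lambda>c. [:c:]) p) = degree p"
      by (rule degree_map_poly) simp
    with that show ?thesis
      unfolding bi_def by (subst degree_add_eq_left) auto
  qed
  have deg_sl: "degree (sl p u t) = degree p" if "degree p > 0" for p u t
    unfolding sl_def using that by (subst degree_add_eq_left) auto
  have map_bi: "map_poly (\<lambda>q. poly q t) (bi p u) = sl p u t" for p u t
    unfolding bi_def sl_def by (rule poly_eqI) (auto simp: coeff_map_poly coeff_pCons split: nat.splits)
  define R where "R = resultant (bi X U) (bi Y V)"
  have R: "poly R t = 0 \<longleftrightarrow> (\<exists>s. poly X s = poly U t \<and> poly Y s = poly V t)" for t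
  proof -
    have ev: "comm_ring_hom (\<lambda>q. poly q t)"
      by standard auto
    have "poly R t = resultant (sl X U t) (sl Y V t)"
      unfolding R_def using degX False
      by (subst comm_ring_hom.resultant_map_poly[OF ev, symmetric]) (simp_all add: map_bi deg_bi deg_sl)
    then show ?thesis
      using common_root_iff_resultant[of "sl X U t" "sl Y V t"] degX
      by (simp add: deg_sl) (simp add: sl_def)
  qed
  have "infinite {t. poly R t = 0}"
    using inf by (simp add: R)
  then have "R = 0"
    using poly_roots_finite by blast
  then show ?thesis
    using R[of t] by simp
qed

section \<open>Growth of complex polynomials\<close>

text \<open>Write \<open>p s = a + s * q s\<close> with \<open>q\<close> nonzero. For large
  \<open>s\<close> the norm of \<open>q s\<close> is at least some \<open>c > 0\<close>, so
  \<open>p s - a\<close> has norm at least \<open>c * norm s\<close>; the constant \<open>B\<close>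
  absorbs \<open>a\<close> and the small \<open>s\<close>.\<close>

lemma norm_le_affine_norm_poly:
  fixes p :: "complex poly"
  assumes "degree p > 0"
  shows "\<exists>A\<ge>0. \<exists>B. \<forall>s. norm s \<le> A * norm (poly p s) + B"
proof -
  obtain a q where p: "p = pCons a q" by (cases p)
  have q: "q \<noteq> 0" using assms p by auto
  have "\<exists>c>0. \<exists>r. \<forall>s. r \<le> norm s \<longrightarrow> c \<le> norm (poly q s)"
  proof (cases "degree q = 0")
    case True
    then obtain b where "q = [:b:]" by (meson degree_eq_zeroE)
    with q show ?thesis by (intro exI[of _ "norm b"]) auto
  next
    case False
    obtain b q' where q': "q = pCons b q'" by (cases q)
    with False have "q' \<noteq> 0" by auto
    from poly_infinity[OF this, of 1 b] show ?thesis
      unfolding q' by (intro exI[of _ 1]) auto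
  qed
  then obtain c r where c: "c > 0" and r: "\<And>s. r \<le> norm s \<Longrightarrow> c \<le> norm (poly q s)"
    by blast
  have "norm s \<le> (1/c) * norm (poly p s) + (\<bar>r\<bar> + norm a / c)" for s
  proof (cases "r \<le> norm s")
    case True
    have "c * norm s \<le> norm (poly q s) * norm s"
      using r[OF True] by (simp add: mult_right_mono)
    also have "\<dots> = norm (poly p s - a)"
      by (simp add: p norm_mult mult.commute)
    also have "\<dots> \<le> norm (poly p s) + norm a"
      by (rule norm_triangle_ineq4)
    finally have "norm s \<le> (norm (poly p s) + norm a) / c"
      using c by (simp add: pos_le_divide_eq mult.commute)
    then show ?thesis
      by (simp add: add_divide_distrib)
  next
    case False
    have "0 \<le> (1/c) * norm (poly p s)" "0 \<le> norm a / c"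
      using c by simp_all
    with False show ?thesis by linarith
  qed
  then show ?thesis
    using c by (intro exI[of _ "1/c"]) auto
qed

lemma norm_poly_le_power_degree:
  fixes p :: "complex poly"
  shows "\<exists>C. \<forall>t. 1 \<le> norm t \<longrightarrow> norm (poly p t) \<le> C * norm t ^ degree p"
proof (intro exI allI impI)
  fix t :: complex
  assume t: "1 \<le> norm t"
  have "norm (poly p t) \<le> (\<Sum>i\<le>degree p. norm (coeff p i * t ^ i))"
    unfolding poly_altdef by (rule norm_sum)
  also have "\<dots> \<le> (\<Sum>i\<le>degree p. norm (coeff p i) * norm t ^ degree p)"
    using t by (intro sum_mono) (auto simp: norm_mult norm_power intro!: mult_left_mono power_increasing)
  finally show "norm (poly p t) \<le> (\<Sum>i\<le>degree p. norm (coeff p i)) * norm t ^ degree p"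
    by (simp add: sum_distrib_right)
qed

section \<open>Differentiability of branches of polynomial equations\<close>

text \<open>By the factor theorem the difference quotient at \<open>s\<close> is itself a
  polynomial, so it makes sense at \<open>w = s\<close> and is continuous there.\<close>

lemma poly_diff_quotient:
  fixes p :: "'a :: {idom} poly"
  obtains q where "\<And>w. poly p w - poly p s = (w - s) * poly q w" "poly q s = poly (pderiv p) s"
proof -
  have "[:- s, 1:] dvd p - [:poly p s:]"
    by (simp only: poly_eq_0_iff_dvd[symmetric]) simp
  then obtain q where q: "p - [:poly p s:] = [:- s, 1:] * q" ..
  have 1: "poly p w - poly p s = (w - s) * poly q w" for w
    using arg_cong[OF q, of "\<lambda>p. poly p w"] by (simp add: algebra_simps)
  have "p = [:- s, 1:] * q + [:poly p s:]"
    using q by (simp add: algebra_simps)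
  then have "pderiv p = pderiv ([:- s, 1:] * q + [:poly p s:])"
    by simp
  then have 2: "poly q s = poly (pderiv p) s"
    by (simp add: pderiv_add pderiv_diff pderiv_smult pderiv_pCons)
  from 1 2 show ?thesis by (rule that)
qed

text \<open>Dividing the polynomial difference quotient of \<open>U\<close> at \<open>t\<close> by
  that of \<open>X\<close> at \<open>\<phi> t\<close> gives the difference quotient of
  \<open>\<phi>\<close>; continuity of \<open>\<phi>\<close> and \<open>reg\<close> let the limit
  pass through the division.\<close>

lemma field_differentiable_poly_branch:
  fixes X U :: "complex poly" and \<phi> :: "complex \<Rightarrow> complex"
  assumes S: "open S" "t \<in> S" and cont: "continuous_on S \<phi>"
    and branch: "\<And>u. u \<in> S \<Longrightarrow> poly X (\<phi> u) = poly U u"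
    and reg: "poly (pderiv X) (\<phi> t) \<noteq> 0"
  shows "\<phi> field_differentiable at t"
proof -
  obtain q where q: "\<And>w. poly X w - poly X (\<phi> t) = (w - \<phi> t) * poly q w"
      "poly q (\<phi> t) = poly (pderiv X) (\<phi> t)"
    by (rule poly_diff_quotient[of X "\<phi> t"]) (rule that)
  obtain r where r: "\<And>u. poly U u - poly U t = (u - t) * poly r u"
    by (rule poly_diff_quotient[of U t]) (rule that)
  have lim: "(\<phi> \<longlongrightarrow> \<phi> t) (at t)"
    using cont S by (metis continuous_on_eq_continuous_at isCont_def)
  have qlim: "((\<lambda>u. poly q (\<phi> u)) \<longlongrightarrow> poly q (\<phi> t)) (at t)"
    by (intro tendsto_intros lim)
  have qnz: "\<forall>\<^sub>F u in at t. poly q (\<phi> u) \<noteq> 0"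
    using tendsto_imp_eventually_ne[OF qlim] reg q(2) by simp
  have "((\<lambda>u. poly r u / poly q (\<phi> u)) \<longlongrightarrow> poly r t / poly q (\<phi> t)) (at t)"
    using reg q(2) by (intro tendsto_intros lim qlim) auto
  moreover have "\<forall>\<^sub>F u in at t. poly r u / poly q (\<phi> u) = (\<phi> u - \<phi> t) / (u - t)"
    using qnz eventually_at_in_open'[OF S] eventually_neq_at_within[of t t]
  proof eventually_elim
    case (elim u)
    have "(\<phi> u - \<phi> t) * poly q (\<phi> u) = (u - t) * poly r u"
      using q(1)[of "\<phi> u"] r[of u] branch elim S by simp
    with elim show ?case
      by (simp add: field_simps)
  qed
  ultimately have "((\<lambda>u. (\<phi> u - \<phi> t) / (u - t)) \<longlongrightarrow> poly r t / poly q (\<phi> t)) (at t)"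
    by (rule Lim_transform_eventually)
  then show ?thesis
    unfolding field_differentiable_def has_field_derivative_iff by blast
qed

section \<open>Affine reparametrization over the complex numbers\<close>

lemma poly_eqI_infinite:
  fixes p q :: "'a :: idom poly"
  assumes "infinite S" "\<And>t. t \<in> S \<Longrightarrow> poly p t = poly q t"
  shows "p = q"
proof -
  have "S \<subseteq> {t. poly (p - q) t = 0}"
    using assms(2) by auto
  then have "infinite {t. poly (p - q) t = 0}"
    using assms(1) finite_subset by blast
  then have "p - q = 0"
    using poly_roots_finite by blast
  then show ?thesis by simp
qed

lemma proper_reparam_affine:
  fixes X Y U V :: "complex poly"
  assumes degX: "degree X > 0" and degU: "degree U = degree X"
    and proper: "finite {t. \<exists>s. s \<noteq> t \<and> poly X s = poly X t \<and> poly Y s = poly Y t}"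
    and preim: "\<And>t. \<exists>s. poly X s = poly U t \<and> poly Y s = poly V t"
  obtains K \<alpha> \<beta> where "finite K" "\<alpha> \<noteq> 0"
    "\<And>t s. t \<notin> K \<Longrightarrow> poly X s = poly U t \<Longrightarrow> poly Y s = poly V t \<Longrightarrow> s = \<alpha> * t + \<beta>"
proof -
  \<comment> \<open>\<open>B\<close> holds the parameters sharing their point with another one,
    \<open>D\<close> the critical points of \<open>X\<close>. Since
    \<open>X (\<phi> t) = U t\<close>, a value \<open>\<phi> t\<close> in \<open>B\<close> or
    \<open>D\<close> puts \<open>t\<close> into \<open>K\<close>. The fibres of the nonconstant
    \<open>U\<close> are finite, hence so is \<open>K\<close>.\<close>
  define B where "B = {t. \<exists>s. s \<noteq> t \<and> poly X s = poly X t \<and> poly Y s = poly Y t}"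
  define D where "D = {s. poly (pderiv X) s = 0}"
  define K where "K = {t. poly U t \<in> poly X ` (B \<union> D)}"
  have "pderiv X \<noteq> 0"
    using degX by (simp add: pderiv_eq_0_iff)
  then have finBD: "finite (B \<union> D)"
    using proper by (simp add: B_def D_def poly_roots_finite)
  have finK: "finite K"
  proof -
    have "K = (\<Union>c\<in>poly X ` (B \<union> D). {t. poly (U - [:c:]) t = 0})"
      by (auto simp: K_def)
    moreover have "U - [:c:] \<noteq> 0" for c
      using degU degX by (metis degree_pCons_0 eq_iff_diff_eq_0 less_numeral_extra(3))
    ultimately show ?thesis
      using finBD poly_roots_finite by (simp only: finite_UN finite_imageI) blast
  qed
  define \<phi> where "\<phi> t = (SOME s. poly X s = poly U t \<and> poly Y s = poly V t)" for t
  have \<phi>: "poly X (\<phi> t) = poly U t" "poly Y (\<phi> t) = poly V t" for t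
    using someI_ex[OF preim[of t]] by (simp_all add: \<phi>_def)
  have uniq: "s = \<phi> t" if "t \<notin> K" "poly X s = poly U t" "poly Y s = poly V t" for s t
  proof -
    have "\<phi> t \<notin> B"
      using that \<phi>[of t] unfolding K_def by (metis (mono_tags, lifting) UnCI imageI mem_Collect_eq)
    with that \<phi> show ?thesis
      by (auto simp: B_def)
  qed
  obtain A b where A: "A \<ge> 0" and Ab: "\<And>s. norm s \<le> A * norm (poly X s) + b"
    using norm_le_affine_norm_poly[OF degX] by blast
  \<comment> \<open>The choice \<open>\<phi>\<close> solves the equations on \<open>K\<close> too,
    so the bound needs no exception there.\<close>
  have bdd: "\<exists>M. \<forall>t\<in>cball 0 r. norm (\<phi> t) \<le> M" for r
  proof -
    have "compact (poly U ` cball 0 r)"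
      by (intro compact_continuous_image continuous_intros compact_cball)
    then obtain M where M: "\<And>t. t \<in> cball 0 r \<Longrightarrow> norm (poly U t) \<le> M"
      by (meson bounded_iff compact_imp_bounded imageI)
    have "norm (\<phi> t) \<le> A * M + b" if "t \<in> cball 0 r" for t
      using Ab[of "\<phi> t"] mult_left_mono[OF M[OF that] A] by (simp add: \<phi>)
    then show ?thesis by blast
  qed
  have opn: "open (ball 0 r - K)" for r
    using finK by (simp add: finite_imp_closed open_Diff)
  have cont: "continuous_on (ball 0 r - K) \<phi>" for r
  proof -
    obtain M where M: "\<forall>t\<in>cball 0 r. norm (\<phi> t) \<le> M"
      using bdd by blast
    \<comment> \<open>A map into a compact set is continuous if its graph is closed; by uniqueness the graph is
      cut out by the two polynomial equations.\<close>
    let ?S = "ball 0 r - K" and ?T = "cball 0 M"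
    let ?G = "{p. poly X (snd p) = poly U (fst p) \<and> poly Y (snd p) = poly V (fst p)}"
    have fim: "\<phi> \<in> ?S \<rightarrow> ?T"
      using M by auto
    have "closed ?G"
      by (intro closed_Collect_conj closed_Collect_eq continuous_intros)
    moreover have "(\<lambda>t. (t, \<phi> t)) ` ?S = (?S \<times> ?T) \<inter> ?G"
      using fim uniq \<phi> by (auto simp: image_iff)
    ultimately have "closedin (top_of_set (?S \<times> ?T)) ((\<lambda>t. (t, \<phi> t)) ` ?S)"
      by (simp add: closedin_closed_Int)
    then show ?thesis
      using continuous_closed_graph_eq[OF compact_cball fim] by blast
  qed
  have "\<phi> field_differentiable at t" if "t \<notin> K" for t
  proof (rule field_differentiable_poly_branch)
    show "open (ball 0 (norm t + 1) - K)" "t \<in> ball 0 (norm t + 1) - K"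
      using opn that by auto
    show "continuous_on (ball 0 (norm t + 1) - K) \<phi>"
      by (rule cont)
    show "poly X (\<phi> u) = poly U u" for u
      by (rule \<phi>)
    show "poly (pderiv X) (\<phi> t) \<noteq> 0"
    proof
      assume "poly (pderiv X) (\<phi> t) = 0"
      then have "poly X (\<phi> t) \<in> poly X ` (B \<union> D)"
        by (auto simp: D_def)
      with that show False by (simp add: K_def \<phi>)
    qed
  qed
  then have hol: "\<phi> holomorphic_on (UNIV - K)"
    by (auto simp: holomorphic_on_def intro: field_differentiable_at_within)
  \<comment> \<open>Local boundedness makes the points of \<open>K\<close> removable
    singularities.\<close>
  have "\<phi> \<in> O[at z](\<lambda>_. 1)" for z
  proof -
    obtain M where M: "\<forall>t\<in>cball 0 (norm z + 1). norm (\<phi> t) \<le> M"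
      using bdd by blast
    have "\<forall>\<^sub>F u in at z. u \<in> ball 0 (norm z + 1)"
      by (rule eventually_at_in_open') auto
    then show ?thesis
      by (intro bigoI[of _ M]) (auto elim!: eventually_mono simp: M)
  qed
  then obtain g where g: "g holomorphic_on UNIV" and g\<phi>: "\<And>t. t \<notin> K \<Longrightarrow> g t = \<phi> t"
    using removable_singularities[OF finK _ hol] by auto
  obtain R where R: "K \<subseteq> ball 0 R"
    using finite_imp_bounded[OF finK] bounded_subset_ballD by blast
  obtain C where C: "\<And>t. 1 \<le> norm t \<Longrightarrow> norm (poly U t) \<le> C * norm t ^ degree U"
    using norm_poly_le_power_degree by blast
  let ?n = "degree U"
  \<comment> \<open>Beyond \<open>R\<close> there are no points of \<open>K\<close>, so
    \<open>g\<close> agrees with \<open>\<phi>\<close>; beyond 1 the constant \<open>b\<close> is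
    absorbed by the power of \<open>norm t\<close>.\<close>
  have growth: "norm (g t) \<le> (A * C + \<bar>b\<bar>) * norm t ^ ?n" if "max 1 R \<le> norm t" for t
  proof -
    have t: "1 \<le> norm t" "t \<notin> K"
      using that R by auto
    have "norm (g t) \<le> A * norm (poly U t) + b"
      using Ab[of "\<phi> t"] t by (simp add: g\<phi> \<phi>)
    also have "\<dots> \<le> A * (C * norm t ^ ?n) + \<bar>b\<bar> * norm t ^ ?n"
    proof (rule add_mono)
      show "A * norm (poly U t) \<le> A * (C * norm t ^ ?n)"
        using A C t by (simp add: mult_left_mono)
      have "\<bar>b\<bar> * 1 \<le> \<bar>b\<bar> * norm t ^ ?n"
        using t by (intro mult_left_mono) auto
      then show "b \<le> \<bar>b\<bar> * norm t ^ ?n" by linarith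
    qed
    finally show ?thesis by (simp add: algebra_simps)
  qed
  \<comment> \<open>By Liouville's theorem for polynomial growth, \<open>g\<close> equals its Taylor
    polynomial at 0 of degree at most \<open>?n\<close>.\<close>
  define G where "G = (\<Sum>k\<le>?n. monom ((deriv ^^ k) g 0 / fact k) k)"
  have G: "g t = poly G t" for t
  proof -
    have "g t = (\<Sum>k\<le>?n. (deriv ^^ k) g 0 / fact k * t ^ k)"
      by (rule Liouville_polynomial[OF g growth])
    then show ?thesis by (simp add: G_def poly_sum poly_monom)
  qed
  have "infinite (- K)"
    using finK by (simp add: infinite_UNIV_char_0)
  then have "pcompose X G = U"
    by (rule poly_eqI_infinite) (simp add: poly_pcompose flip: G, simp add: g\<phi> \<phi>)
  \<comment> \<open>Degrees multiply under composition, and \<open>X\<close> and \<open>U\<close>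
    have the same positive degree.\<close>
  then have "degree G = 1"
    using degU degX degree_pcompose[of X G] by auto
  then obtain \<alpha> \<beta> where \<alpha>\<beta>: "G = [:\<beta>, \<alpha>:]" "\<alpha> \<noteq> 0"
    by (metis degree1_coeffs One_nat_def)
  have "s = \<alpha> * t + \<beta>" if "t \<notin> K" "poly X s = poly U t" "poly Y s = poly V t" for s t
    using uniq[OF that] g\<phi>[of t] G[of t] that by (simp add: \<alpha>\<beta> algebra_simps)
  with that finK \<alpha>\<beta> show ?thesis by blast
qed

section \<open>Descent to real parameters\<close>

lemma poly_map_poly_of_real: "poly (map_poly of_real p) (of_real t :: complex) = of_real (poly p t)"
  by (induction p) (simp_all add: map_poly_pCons)

lemma degree_map_poly_of_real: "degree (map_poly complex_of_real p) = degree p"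
  by (rule degree_map_poly) simp

text \<open>To be used with \<open>(u, v)\<close> the reflected parametrization. Properness speaks
  of complex parameters, so the affine map is found over the complex numbers and then shown to be
  real.\<close>

lemma proper_real_reparam_affine:
  fixes x y u v :: "real poly"
  assumes degx: "degree x > 0" and degu: "degree u = degree x"
    and proper: "proper_param x y"
    and preim: "\<And>t. \<exists>s. poly x s = poly u t \<and> poly y s = poly v t"
  shows "\<exists>\<alpha> \<beta>. \<alpha> \<noteq> 0 \<and> (\<forall>t. poly x (\<alpha> * t + \<beta>) = poly u t \<and> poly y (\<alpha> * t + \<beta>) = poly v t)"
proof -
  let ?c = "map_poly complex_of_real"
  have preimc: "\<exists>s. poly (?c x) s = poly (?c u) t \<and> poly (?c y) s = poly (?c v) t" for t
  proof (rule common_preimage_everywhere)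
    show "degree (?c x) > 0"
      using degx by (simp add: degree_map_poly_of_real)
    have "range complex_of_real \<subseteq> {t. \<exists>s. poly (?c x) s = poly (?c u) t \<and> poly (?c y) s = poly (?c v) t}"
    proof clarify
      fix t :: real
      obtain s where "poly x s = poly u t" "poly y s = poly v t"
        using preim by blast
      then show "\<exists>s. poly (?c x) s = poly (?c u) (of_real t) \<and> poly (?c y) s = poly (?c v) (of_real t)"
        by (intro exI[of _ "of_real s"]) (simp add: poly_map_poly_of_real)
    qed
    moreover have "infinite (range complex_of_real)"
      by (simp add: finite_image_iff inj_of_real infinite_UNIV_char_0)
    ultimately show "infinite {t. \<exists>s. poly (?c x) s = poly (?c u) t \<and> poly (?c y) s = poly (?c v) t}"
      using finite_subset by blast
  qed
  obtain K a b where K: "finite K" and "a \<noteq> 0"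
    and aff: "\<And>t s. t \<notin> K \<Longrightarrow> poly (?c x) s = poly (?c u) t \<Longrightarrow> poly (?c y) s = poly (?c v) t
        \<Longrightarrow> s = a * t + b"
    using proper_reparam_affine[of "?c x" "?c u" "?c y" "?c v", OF _ _ _ preimc] degx degu proper
    by (auto simp: degree_map_poly_of_real proper_param_def)
  define J where "J = {t::real. of_real t \<notin> K}"
  have "finite (of_real -` K :: real set)"
    using K by (simp add: finite_vimageI inj_of_real)
  moreover have "J = - (of_real -` K)"
    by (auto simp: J_def)
  ultimately have J: "infinite J"
    by (simp add: infinite_UNIV_char_0)
  have aff_real: "\<exists>s. poly x s = poly u t \<and> poly y s = poly v t \<and> of_real s = a * of_real t + b"
    if "t \<in> J" for t
  proof -
    obtain s where "poly x s = poly u t" "poly y s = poly v t"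
      using preim by blast
    with aff[of "of_real t" "of_real s"] that show ?thesis
      by (auto simp: J_def poly_map_poly_of_real)
  qed
  \<comment> \<open>Two distinct real parameters with real images determine the slope
    \<open>a\<close> and then the intercept \<open>b\<close> as real numbers.\<close>
  obtain t1 where t1: "t1 \<in> J"
    using J by (metis equals0I finite.emptyI)
  moreover obtain t2 where t2: "t2 \<in> J" "t2 \<noteq> t1"
    using J by (metis finite.emptyI finite_insert finite_subset insertI1 subsetI singletonD)
  ultimately obtain s1 s2 where s: "of_real s1 = a * of_real t1 + b" "of_real s2 = a * of_real t2 + b"
    using aff_real by metis
  then have "a * of_real (t2 - t1) = of_real (s2 - s1)"
    by (simp add: algebra_simps)
  then have "a = of_real ((s2 - s1) / (t2 - t1))"
    using t2 by (simp add: field_simps)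
  then obtain \<alpha> where \<alpha>: "a = of_real \<alpha>" by blast
  have "b = of_real (s1 - \<alpha> * t1)"
    using s by (simp add: \<alpha>)
  then obtain \<beta> where \<beta>: "b = of_real \<beta>" by blast
  have *: "poly x (\<alpha> * t + \<beta>) = poly u t \<and> poly y (\<alpha> * t + \<beta>) = poly v t" if t: "t \<in> J" for t
  proof -
    obtain s where s: "poly x s = poly u t" "poly y s = poly v t" "complex_of_real s = a * of_real t + b"
      using aff_real[OF t] by blast
    have "complex_of_real s = of_real (\<alpha> * t + \<beta>)"
      by (simp add: s \<alpha> \<beta>)
    then have "s = \<alpha> * t + \<beta>"
      by (simp only: of_real_eq_iff)
    with s show ?thesis by simp
  qed
  \<comment> \<open>Polynomial identities on the infinite set \<open>J\<close> hold everywhere,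
    which covers the parameters in \<open>K\<close>.\<close>
  have "pcompose x [:\<beta>, \<alpha>:] = u" "pcompose y [:\<beta>, \<alpha>:] = v"
    using * by (auto intro!: poly_eqI_infinite[OF J] simp: poly_pcompose algebra_simps)
  then have "poly x (\<alpha> * t + \<beta>) = poly u t \<and> poly y (\<alpha> * t + \<beta>) = poly v t" for t
    using poly_pcompose[of x "[:\<beta>, \<alpha>:]" t] poly_pcompose[of y "[:\<beta>, \<alpha>:]" t] by (simp add: algebra_simps)
  then show ?thesis
    using \<open>a \<noteq> 0\<close> \<alpha> by auto
qed

section \<open>Point reflections of the curve\<close>

lemma proper_param_commute: "proper_param x y \<longleftrightarrow> proper_param y x"
  by (simp add: proper_param_def conj_commute)

lemma symmetric_wrt_pcurve_iff:
  assumes nonconst: "degree x > 0 \<or> degree y > 0"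
    and proper: "proper_param x y"
  shows "symmetric_wrt (pcurve x y) w \<longleftrightarrow>
    (\<exists>\<alpha> \<beta>::real. \<alpha> \<noteq> 0 \<and> (\<forall>t. - zpar x y t + 2 * w = zpar x y (\<alpha> * t + \<beta>)))"
proof
  assume sym: "symmetric_wrt (pcurve x y) w"
  \<comment> \<open>The coordinates of \<open>z\<^sup>\<star>\<close>: reflection negates the
    nonconstant coefficients, so a positive degree is preserved.\<close>
  define mir where "mir c p = [:2 * c:] - p" for c and p :: "real poly"
  have deg: "degree (mir c p) = degree p" if "degree p > 0" for c p
    unfolding mir_def using that degree_add_eq_right[of "[:2 * c:]" "- p"] by simp
  have preim: "\<exists>s. poly x s = poly (mir (Re w) x) t \<and> poly y s = poly (mir (Im w) y) t" for t
  proof -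
    have "2 * w - zpar x y t \<in> pcurve x y"
      using sym unfolding symmetric_wrt_def pcurve_def by blast
    then show ?thesis
      by (auto simp: pcurve_def zpar_def mir_def complex_eq_iff)
  qed
  have "\<exists>\<alpha> \<beta>. \<alpha> \<noteq> 0 \<and> (\<forall>t. poly x (\<alpha> * t + \<beta>) = poly (mir (Re w) x) t
      \<and> poly y (\<alpha> * t + \<beta>) = poly (mir (Im w) y) t)"
    using nonconst
  proof
    assume "degree x > 0"
    then show ?thesis
      using proper_real_reparam_affine[OF _ deg proper preim] by blast
  next
    \<comment> \<open>The coordinates are interchanged so that the nonconstant one comes
      first.\<close>
    assume "degree y > 0"
    then show ?thesis
      using proper_real_reparam_affine[of y "mir (Im w) y" x "mir (Re w) x"] deg proper preim
      by (metis proper_param_commute)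
  qed
  then show "\<exists>\<alpha> \<beta>::real. \<alpha> \<noteq> 0 \<and> (\<forall>t. - zpar x y t + 2 * w = zpar x y (\<alpha> * t + \<beta>))"
    by (simp add: zpar_def mir_def complex_eq_iff) metis
next
  assume "\<exists>\<alpha> \<beta>::real. \<alpha> \<noteq> 0 \<and> (\<forall>t. - zpar x y t + 2 * w = zpar x y (\<alpha> * t + \<beta>))"
  then obtain \<alpha> \<beta> where \<alpha>: "\<alpha> \<noteq> 0" and eq: "\<And>t. 2 * w - zpar x y t = zpar x y (\<alpha> * t + \<beta>)"
    by auto
  \<comment> \<open>The reflected curve is the original one traced with an affine change of
    parameter, which is onto, so both have the same range.\<close>
  have "surj (\<lambda>t. \<alpha> * t + \<beta>)"
    using \<alpha> by (intro surjI[of _ "\<lambda>s. (s - \<beta>) / \<alpha>"]) simp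
  then have "range (\<lambda>t. zpar x y (\<alpha> * t + \<beta>)) = range (zpar x y)"
    by (metis image_image)
  then show "symmetric_wrt (pcurve x y) w"
    by (simp add: symmetric_wrt_def pcurve_def image_image eq)
qed

theorem theorem4:
  fixes x y :: "real poly" and z0 :: complex
  assumes nonconst: "degree x > 0 \<or> degree y > 0"
    and proper: "proper_param x y"
  shows "(symmetric_wrt (pcurve x y) z0 \<longleftrightarrow>
            (\<exists>\<alpha> \<beta>::real. \<alpha> \<noteq> 0 \<and> (\<forall>t. - zpar x y t + 2 * z0 = zpar x y (\<alpha> * t + \<beta>))))
       \<and> (central_symmetry (pcurve x y) \<longleftrightarrow>
            (\<exists>w0 \<alpha> \<beta>. \<alpha> \<noteq> (0::real) \<and> (\<forall>t. - zpar x y t + 2 * w0 = zpar x y (\<alpha> * t + \<beta>))))"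
  by (simp only: central_symmetry_def symmetric_wrt_pcurve_iff[OF assms] simp_thms)

end
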